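(* Let $G$ be a monoid, let $\mu,\chi:G\to\mathbb{C}$ be different nonzero multiplicative functions, let $A:G\to\mathbb{C}$ be an additive function such that $\chi A\neq 0$, and put $g:=\frac{\mu+\chi}{2}$. The solutions $f,h_1,h_2,h:G\to\mathbb{C}$ of the functional equation $$f(xy)=f(x)h_1(y)+g(x)h_2(y)+\chi(x)A(x)h(y)\quad\text{for all }x,y\in G$$ are exactly the quadruples $(f,h_1,h_2,h)$ of one of the following forms: (1) $f=cm$, $h_1=m$, $h_2=h=0$, where $m:G\to\mathbb{C}$ is a nonzero multiplicative function and $c\in\mathbb{C}\setminus\{0\}$ is a constant such that $m\neq\mu$ and $m\neq\chi$; (2) $f=0$, $h_1$ is arbitrary and $h_2=h=0$; (3) $f=a\mu+b\chi+c\chi A$, $h_1=\frac{1}{a-b}(a\mu-b\chi-c\chi A)$, $h_2=\frac{2a}{a-b}(-b\mu+b\chi+c\chi A)$ and $h=\frac{c}{a-b}(-a\mu+a\chi+c\chi A)$, where $a,b,c\in\mathbb{C}$ are constants such that $(a,b,c)\neq(0,0,0)$ and $a\neq b$.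
   Context: A function $A:G\to\mathbb{C}$ is additive if $A(xy)=A(x)+A(y)$ for all $x,y\in G$. A function $m:G\to\mathbb{C}$ is multiplicative if $m(xy)=m(x)m(y)$ for all $x,y\in G$; it is nonzero if it is not the zero function (it may take the value $0$). $\chi A$ denotes the pointwise product. "Arbitrary" means an arbitrary function $G\to\mathbb{C}$. *)

theory Defs
  imports Complex_Main
begin

definition additive_fun :: "('a::monoid_mult \<Rightarrow> complex) \<Rightarrow> bool" where
  "additive_fun A \<longleftrightarrow> (\<forall>x y. A (x * y) = A x + A y)"

definition multiplicative_fun :: "('a::monoid_mult \<Rightarrow> complex) \<Rightarrow> bool" where
  "multiplicative_fun m \<longleftrightarrow> (\<forall>x y. m (x * y) = m x * m y)"

end

(* The functions \<mu>, \<chi>, \<chi>A are linearly independent. If f lies in their span, comparing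
   coefficients of f (x y) as a function of x determines h\<^sub>1, h\<^sub>2, h. Otherwise f, \<mu>, \<chi>, \<chi>A are
   independent, and evaluating f (x y z) in two ways shows that h\<^sub>1 is multiplicative and
   (\<mu> - \<chi>)(y) h\<^sub>2(z) = 2 (\<chi>A)(y) h(z), whence h\<^sub>2 = h = 0. *)
theory Submission imports Defs begin

lemma multiplicative_fun_one:
  assumes "multiplicative_fun m" and "m \<noteq> (\<lambda>x. 0)"
  shows "m 1 = 1"
proof -
  obtain x where "m x \<noteq> 0" using assms(2) by auto
  moreover have "m x = m x * m 1"
    using assms(1) unfolding multiplicative_fun_def by (metis mult_1_right)
  ultimately show ?thesis by simp
qed

lemma additive_fun_one: "additive_fun A \<Longrightarrow> A 1 = 0"
  unfolding additive_fun_def by (metis add_cancel_right_right mult_1_right)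

text \<open>Right translation by \<open>y\<close> scales \<mu> by \<open>\<mu> y\<close>, and on the
  span of \<chi> and \<chi>A it is triangular with sole eigenvalue \<open>\<chi> y\<close>. A point
  \<open>y\<close> where the two values differ therefore separates \<mu> from the other two
  functions.\<close>

lemma mult_char_independent:
  fixes \<mu> \<chi> A :: "'a::monoid_mult \<Rightarrow> complex"
  assumes mu: "multiplicative_fun \<mu>" "\<mu> \<noteq> (\<lambda>x. 0)"
    and chi: "multiplicative_fun \<chi>" "\<chi> \<noteq> (\<lambda>x. 0)"
    and ne: "\<mu> \<noteq> \<chi>"
    and A: "additive_fun A"
    and chiA: "(\<lambda>x. \<chi> x * A x) \<noteq> (\<lambda>x. 0)"
    and rel: "\<And>x. \<alpha> * \<mu> x + \<beta> * \<chi> x + \<gamma> * (\<chi> x * A x) = 0"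
  shows "\<alpha> = 0" and "\<beta> = 0" and "\<gamma> = 0"
proof -
  note one = multiplicative_fun_one[OF mu] multiplicative_fun_one[OF chi] additive_fun_one[OF A]
  have sum0: "\<alpha> + \<beta> = 0" using rel[of 1] by (simp add: one)
  obtain y where y: "\<mu> y \<noteq> \<chi> y" using ne by auto
  \<comment> \<open>Subtracting \<open>\<chi> y\<close> times the relation at \<open>x\<close> from the relation at \<open>x * y\<close> removes \<open>\<chi> A\<close>.\<close>
  have red: "\<alpha> * (\<mu> y - \<chi> y) * \<mu> x + \<gamma> * \<chi> y * A y * \<chi> x = 0" for x
  proof -
    have "\<alpha> * (\<mu> x * \<mu> y) + \<beta> * (\<chi> x * \<chi> y) + \<gamma> * (\<chi> x * \<chi> y * (A x + A y)) = 0"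
      using rel[of "x * y"] mu(1) chi(1) A
      by (simp add: multiplicative_fun_def additive_fun_def)
    with rel[of x] show ?thesis by algebra
  qed
  \<comment> \<open>At \<open>1\<close> both \<mu> and \<chi> equal 1, so \<open>red\<close> ties
    its two coefficients together and becomes a multiple of \<open>\<mu> x - \<chi> x\<close>; the
    choice \<open>x = y\<close> then isolates \<alpha>.\<close>
  have "\<gamma> * \<chi> y * A y = - (\<alpha> * (\<mu> y - \<chi> y))"
    using red[of 1] by (simp add: one eq_neg_iff_add_eq_0 add.commute)
  with red have "\<alpha> * (\<mu> y - \<chi> y) * (\<mu> x - \<chi> x) = 0" for x
    by (metis (no_types, lifting) mult_minus_left right_diff_distrib uminus_add_conv_diff add.commute)
  with y show a0: "\<alpha> = 0" by fastforce
  with sum0 show b0: "\<beta> = 0" by simp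
  show "\<gamma> = 0" using rel chiA a0 b0 by fastforce
qed

theorem theorem6p2:
  fixes \<mu> \<chi> A g f h\<^sub>1 h\<^sub>2 h :: "'a::monoid_mult \<Rightarrow> complex"
  assumes "multiplicative_fun \<mu>" and "\<mu> \<noteq> (\<lambda>x. 0)"
    and "multiplicative_fun \<chi>" and "\<chi> \<noteq> (\<lambda>x. 0)"
    and "\<mu> \<noteq> \<chi>"
    and "additive_fun A"
    and "(\<lambda>x. \<chi> x * A x) \<noteq> (\<lambda>x. 0)"
    and "g = (\<lambda>x. (\<mu> x + \<chi> x) / 2)"
  shows "(\<forall>x y. f (x * y) = f x * h\<^sub>1 y + g x * h\<^sub>2 y + \<chi> x * A x * h y) \<longleftrightarrow>
     (\<exists>m c. multiplicative_fun m \<and> m \<noteq> (\<lambda>x. 0) \<and> c \<noteq> 0 \<and> m \<noteq> \<mu> \<and> m \<noteq> \<chi> \<and>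
        f = (\<lambda>x. c * m x) \<and> h\<^sub>1 = m \<and> h\<^sub>2 = (\<lambda>x. 0) \<and> h = (\<lambda>x. 0)) \<or>
     (f = (\<lambda>x. 0) \<and> h\<^sub>2 = (\<lambda>x. 0) \<and> h = (\<lambda>x. 0)) \<or>
     (\<exists>a b c. (a, b, c) \<noteq> (0, 0, 0) \<and> a \<noteq> b \<and>
        f = (\<lambda>x. a * \<mu> x + b * \<chi> x + c * (\<chi> x * A x)) \<and>
        h\<^sub>1 = (\<lambda>x. 1 / (a - b) * (a * \<mu> x - b * \<chi> x - c * (\<chi> x * A x))) \<and>
        h\<^sub>2 = (\<lambda>x. 2 * a / (a - b) * (- b * \<mu> x + b * \<chi> x + c * (\<chi> x * A x))) \<and>
        h = (\<lambda>x. c / (a - b) * (- a * \<mu> x + a * \<chi> x + c * (\<chi> x * A x))))"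
  (is "?eq \<longleftrightarrow> ?one \<or> ?two \<or> ?three")
proof -
  have mu: "\<mu> (x * y) = \<mu> x * \<mu> y" and chi: "\<chi> (x * y) = \<chi> x * \<chi> y"
    and A: "A (x * y) = A x + A y" for x y
    using assms(1,3,6) by (auto simp: multiplicative_fun_def additive_fun_def)
  note one = multiplicative_fun_one[OF assms(1,2)] multiplicative_fun_one[OF assms(3,4)]
    additive_fun_one[OF assms(6)]
  note indep = mult_char_independent[OF assms(1-7)]
  have gx: "2 * g x = \<mu> x + \<chi> x" for x using assms(8) by simp
  have "?eq" if "?one \<or> ?two \<or> ?three"
  proof -
    have ?eq if ?one using that by (auto simp: multiplicative_fun_def)
    moreover have ?eq if ?two using that by simp
    moreover have ?eq if three: ?three
    proof -
      from three obtain a b c where ab: "a \<noteq> b"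
        and F: "f = (\<lambda>x. a * \<mu> x + b * \<chi> x + c * (\<chi> x * A x))"
        and H1: "h\<^sub>1 = (\<lambda>x. 1 / (a - b) * (a * \<mu> x - b * \<chi> x - c * (\<chi> x * A x)))"
        and H2: "h\<^sub>2 = (\<lambda>x. 2 * a / (a - b) * (- b * \<mu> x + b * \<chi> x + c * (\<chi> x * A x)))"
        and H: "h = (\<lambda>x. c / (a - b) * (- a * \<mu> x + a * \<chi> x + c * (\<chi> x * A x)))"
        by auto
      have d: "a - b \<noteq> 0" using ab by simp
      show ?eq
      proof (intro allI)
        fix x y
        have e1: "(a - b) * h\<^sub>1 y = a * \<mu> y - b * \<chi> y - c * (\<chi> y * A y)"
          using d by (simp add: H1)
        have e2: "(a - b) * h\<^sub>2 y = 2 * a * (- b * \<mu> y + b * \<chi> y + c * (\<chi> y * A y))"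
          using d by (simp add: H2)
        have e3: "(a - b) * h y = c * (- a * \<mu> y + a * \<chi> y + c * (\<chi> y * A y))"
          using d by (simp add: H)
        have e5: "f x = a * \<mu> x + b * \<chi> x + c * (\<chi> x * A x)" by (simp add: F)
        have e6: "f (x * y) = a * (\<mu> x * \<mu> y) + b * (\<chi> x * \<chi> y) + c * (\<chi> x * \<chi> y * (A x + A y))"
          by (simp add: F mu chi A)
        \<comment> \<open>Scaling by \<open>a - b\<close> clears all denominators, so that a
          polynomial identity in the values at \<open>x\<close> and \<open>y\<close>
          remains.\<close>
        have "(a - b) * f (x * y) =
          f x * ((a - b) * h\<^sub>1 y) + g x * ((a - b) * h\<^sub>2 y) + \<chi> x * A x * ((a - b) * h y)"
          unfolding e1 e2 e3 e5 e6 using gx[of x] by algebra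
        then have "(a - b) * f (x * y) =
          (a - b) * (f x * h\<^sub>1 y + g x * h\<^sub>2 y + \<chi> x * A x * h y)"
          by (simp add: algebra_simps)
        with d show "f (x * y) = f x * h\<^sub>1 y + g x * h\<^sub>2 y + \<chi> x * A x * h y"
          by simp
      qed
    qed
    ultimately show ?eq using that by blast
  qed
  moreover have "?one \<or> ?two \<or> ?three" if ?eq
  proof -
    have eq: "f (x * y) = f x * h\<^sub>1 y + g x * h\<^sub>2 y + \<chi> x * A x * h y" for x y
      using that by blast
    show ?thesis
    proof (cases "\<exists>a b c. \<forall>x. f x = a * \<mu> x + b * \<chi> x + c * (\<chi> x * A x)")
      case True
      then obtain a b c where F: "f x = a * \<mu> x + b * \<chi> x + c * (\<chi> x * A x)" for x by blast
      \<comment> \<open>Twice the equation, the factor absorbing the half in \<open>g\<close>, read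
        for fixed \<open>y\<close> as a vanishing combination of \<mu>, \<chi> and \<chi>A in
        \<open>x\<close>.\<close>
      have rel: "(2 * a * (\<mu> y - h\<^sub>1 y) - h\<^sub>2 y) * \<mu> x
          + (2 * (b * \<chi> y + c * (\<chi> y * A y) - b * h\<^sub>1 y) - h\<^sub>2 y) * \<chi> x
          + (2 * (c * \<chi> y - c * h\<^sub>1 y - h y)) * (\<chi> x * A x) = 0" for x y
        using eq[of x y] gx[of x] unfolding F mu chi A by algebra
      have c1: "2 * a * (\<mu> y - h\<^sub>1 y) - h\<^sub>2 y = 0"
        and c2: "2 * (b * \<chi> y + c * (\<chi> y * A y) - b * h\<^sub>1 y) - h\<^sub>2 y = 0"
        and c3: "c * \<chi> y - c * h\<^sub>1 y - h y = 0" for y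
        using indep[OF rel[of y]] by (simp_all only: mult_eq_0_iff) simp
      \<comment> \<open>Subtracting \<open>c2\<close> from \<open>c1\<close> eliminates
        \<open>h\<^sub>2\<close>.\<close>
      have k1: "(a - b) * h\<^sub>1 y = a * \<mu> y - b * \<chi> y - c * (\<chi> y * A y)" for y
      proof -
        have "2 * ((a - b) * h\<^sub>1 y) = 2 * (a * \<mu> y - b * \<chi> y - c * (\<chi> y * A y))"
          using c1[of y] c2[of y] by algebra
        then show ?thesis by (simp only: mult_cancel_left) simp
      qed
      show ?thesis
      proof (cases "a = b")
        case True
        \<comment> \<open>Here the left side of \<open>k1\<close> vanishes, so its right side is a
          linear relation and all coefficients are 0. Hence \<open>f = 0\<close>, and
          \<open>c1\<close> and \<open>c3\<close> give \<open>h\<^sub>2 = h = 0\<close>.\<close>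
        have "a = 0" "- b = 0" "- c = 0"
          using indep[of a "- b" "- c"] k1 True by simp_all
        then have ?two using F c1 c3 by (auto simp: fun_eq_iff)
        then show ?thesis by blast
      next
        case False
        then have d: "a - b \<noteq> 0" by simp
        have H1: "h\<^sub>1 y = 1 / (a - b) * (a * \<mu> y - b * \<chi> y - c * (\<chi> y * A y))" for y
          using k1[of y] d by (simp add: field_simps)
        \<comment> \<open>Multiply \<open>c1\<close> by \<open>a - b\<close> and substitute
          \<open>k1\<close> for \<open>(a - b) * h\<^sub>1 y\<close>; the same is done below with
          \<open>c3\<close> for \<open>h\<close>.\<close>
        have "(a - b) * h\<^sub>2 y = 2 * a * (- b * \<mu> y + b * \<chi> y + c * (\<chi> y * A y))" for y
          using c1[of y] k1[of y] by algebra
        then have H2: "h\<^sub>2 y = 2 * a / (a - b) * (- b * \<mu> y + b * \<chi> y + c * (\<chi> y * A y))" for y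
          using d by (simp add: field_simps)
        have "(a - b) * h y = c * (- a * \<mu> y + a * \<chi> y + c * (\<chi> y * A y))" for y
          using c3[of y] k1[of y] by algebra
        then have H: "h y = c / (a - b) * (- a * \<mu> y + a * \<chi> y + c * (\<chi> y * A y))" for y
          using d by (simp add: field_simps)
        have ?three
          using False by (intro exI[of _ a] exI[of _ b] exI[of _ c] conjI ext F H1 H2 H) auto
        then show ?thesis by blast
      qed
    next
      case False
      \<comment> \<open>If \<open>p\<close> were nonzero, dividing by it would put \<open>f\<close>
        in the span excluded in this case; once \<open>p = 0\<close>, the three-function
        independence applies.\<close>
      have indep4: "p = 0" "\<alpha> = 0" "\<beta> = 0" "\<gamma> = 0"
        if r: "\<And>x. p * f x + \<alpha> * \<mu> x + \<beta> * \<chi> x + \<gamma> * (\<chi> x * A x) = 0" for p \<alpha> \<beta> \<gamma>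
      proof -
        show p: "p = 0"
        proof (rule ccontr)
          assume p: "p \<noteq> 0"
          have "f x = (- \<alpha> / p) * \<mu> x + (- \<beta> / p) * \<chi> x + (- \<gamma> / p) * (\<chi> x * A x)" for x
          proof -
            have "p * f x = - (\<alpha> * \<mu> x + \<beta> * \<chi> x + \<gamma> * (\<chi> x * A x))"
              using r[of x] by algebra
            then have "f x = - (\<alpha> * \<mu> x + \<beta> * \<chi> x + \<gamma> * (\<chi> x * A x)) / p"
              using p by (metis nonzero_mult_div_cancel_left)
            then show ?thesis by (simp add: add_divide_distrib diff_divide_distrib)
          qed
          with False show False by blast
        qed
        show "\<alpha> = 0" "\<beta> = 0" "\<gamma> = 0" using indep[of \<alpha> \<beta> \<gamma>] r p by simp_all
      qed
      \<comment> \<open>Compare \<open>f (x * (y * z))\<close>, expanded once, with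
        \<open>f ((x * y) * z)\<close>, expanded twice; the result is doubled and collected as a
        relation in \<open>x\<close>.\<close>
      have rel: "2 * (h\<^sub>1 (y * z) - h\<^sub>1 y * h\<^sub>1 z) * f x
          + (h\<^sub>2 (y * z) - h\<^sub>2 y * h\<^sub>1 z - \<mu> y * h\<^sub>2 z) * \<mu> x
          + (h\<^sub>2 (y * z) - h\<^sub>2 y * h\<^sub>1 z - \<chi> y * h\<^sub>2 z - 2 * (\<chi> y * A y * h z)) * \<chi> x
          + 2 * (h (y * z) - h y * h\<^sub>1 z - \<chi> y * h z) * (\<chi> x * A x) = 0" for x y z
      proof -
        have "f x * h\<^sub>1 (y * z) + g x * h\<^sub>2 (y * z) + \<chi> x * A x * h (y * z) = f (x * y * z)"
          using eq[of x "y * z"] by (simp add: mult.assoc)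
        also have "\<dots> = (f x * h\<^sub>1 y + g x * h\<^sub>2 y + \<chi> x * A x * h y) * h\<^sub>1 z
            + g (x * y) * h\<^sub>2 z + \<chi> (x * y) * A (x * y) * h z"
          using eq[of "x * y" z] eq[of x y] by simp
        finally show ?thesis using gx[of x] gx[of "x * y"] unfolding mu chi A by algebra
      qed
      note coeffs = indep4[OF rel]
      have m: "multiplicative_fun h\<^sub>1"
        using coeffs(1) by (simp add: multiplicative_fun_def)
      \<comment> \<open>The coefficients of \<mu> and \<chi> share the terms
        \<open>h\<^sub>2 (y * z) - h\<^sub>2 y * h\<^sub>1 z\<close>. Their difference is a relation
        in \<open>y\<close> with \<open>z\<close> fixed, so independence applies a second
        time.\<close>
      have "h\<^sub>2 z * \<mu> y + (- h\<^sub>2 z) * \<chi> y + (- 2 * h z) * (\<chi> y * A y) = 0" for y z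
        using coeffs(2)[of y z] coeffs(3)[of y z] by algebra
      from indep[OF this] have h2: "h\<^sub>2 z = 0" and h: "h z = 0" for z by simp_all
      \<comment> \<open>Setting \<open>x = 1\<close> supplies the constant
        \<open>c = f 1\<close>.\<close>
      have "f y = f 1 * h\<^sub>1 y" for y using eq[of 1 y] by (simp add: h2 h)
      then obtain c where F: "f y = c * h\<^sub>1 y" for y by blast
      \<comment> \<open>All side conditions of the first form come from here: \<open>c = 0\<close>,
        \<open>h\<^sub>1 = 0\<close>, \<open>h\<^sub>1 = \<mu>\<close> or
        \<open>h\<^sub>1 = \<chi>\<close> would each put \<open>f = c h\<^sub>1\<close> in the span
        of \<mu> and \<chi>.\<close>
      have notin: "f \<noteq> (\<lambda>x. a * \<mu> x + b * \<chi> x)" for a b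
      proof
        assume "f = (\<lambda>x. a * \<mu> x + b * \<chi> x)"
        then have "\<forall>x. f x = a * \<mu> x + b * \<chi> x + 0 * (\<chi> x * A x)" by simp
        with False show False by blast
      qed
      have nz: "c \<noteq> 0" "h\<^sub>1 \<noteq> (\<lambda>x. 0)"
        using notin[of 0 0] F by (auto simp: fun_eq_iff)
      have "h\<^sub>1 \<noteq> \<mu>" using notin[of c 0] F by (auto simp: fun_eq_iff)
      moreover have "h\<^sub>1 \<noteq> \<chi>" using notin[of 0 c] F by (auto simp: fun_eq_iff)
      ultimately have ?one using m nz F h2 h
        by (intro exI[of _ h\<^sub>1] exI[of _ c]) (auto simp: fun_eq_iff)
      then show ?thesis by blast
    qed
  qed
  ultimately show ?thesis by blast
qed

end
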